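(* Let $r\ge 1$ and let $N\in\mathcal{M}_r$ be a matroid that can be obtained from $P_r$ by a finite sequence of the operations of complementation, switching, and local complementation. Then $N$ can be obtained from $P_r$ by a finite sequence of the operations of switching and local complementation only.
   Context: $P_r=PG(r-1,2)$ is the rank-$r$ binary projective geometry, i.e. the simple binary matroid on the nonzero vectors of $GF(2)^r$. $\mathcal{M}_r$ is the set of all restrictions of the fixed matroid $P_r$ (to arbitrary subsets of $E(P_r)$). For $M\in\mathcal{M}_r$ and $A\subseteq E(P_r)$, $M\triangle A$ denotes the restriction of $P_r$ to the symmetric difference $E(M)\bigtriangleup A$, and $\mathrm{cl}_{P_r}$ is closure in $P_r$. Operations on $\mathcal{M}_r$: complementation $\omega(M)=M\triangle E(P_r)$; and, for each cocircuit $C^*$ of $P_r$, switching $\sigma_{C^*}(M)=M\triangle C^*$ and local complementation $\lambda_{C^*}(M)=M\triangle[\mathrm{cl}_{P_r}(E(M)\cap C^* )-C^*]$. These may be used with respect to any cocircuit $C^*$ of $P_r$. *)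

theory Defs
  imports "HOL-Analysis.Cartesian_Space" "HOL-Library.Z2"
begin

section \<open>Finite matroids by independent sets\<close>

datatype 'a matroid = Matroid (ground: "'a set") (indep_sets: "'a set set")

definition is_matroid :: "'a matroid \<Rightarrow> bool" where
  "is_matroid M \<longleftrightarrow>
     finite (ground M) \<and> indep_sets M \<subseteq> Pow (ground M) \<and> {} \<in> indep_sets M \<and>
     (\<forall>I J. I \<in> indep_sets M \<and> J \<subseteq> I \<longrightarrow> J \<in> indep_sets M) \<and>
     (\<forall>I J. I \<in> indep_sets M \<and> J \<in> indep_sets M \<and> card I < card J \<longrightarrow>
        (\<exists>x\<in>J - I. insert x I \<in> indep_sets M))"

definition matroid_basis :: "'a matroid \<Rightarrow> 'a set \<Rightarrow> bool" where
  "matroid_basis M B \<longleftrightarrow>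
     B \<in> indep_sets M \<and> (\<forall>I\<in>indep_sets M. B \<subseteq> I \<longrightarrow> I = B)"

definition dual :: "'a matroid \<Rightarrow> 'a matroid" where
  "dual M = Matroid (ground M) {X. X \<subseteq> ground M \<and> (\<exists>B. matroid_basis M B \<and> X \<inter> B = {})}"

definition circuit :: "'a matroid \<Rightarrow> 'a set \<Rightarrow> bool" where
  "circuit M C \<longleftrightarrow>
     C \<subseteq> ground M \<and> C \<notin> indep_sets M \<and> (\<forall>D. D \<subset> C \<longrightarrow> D \<in> indep_sets M)"

definition cocircuit :: "'a matroid \<Rightarrow> 'a set \<Rightarrow> bool" where
  "cocircuit M C \<longleftrightarrow> circuit (dual M) C"

definition matroid_rank :: "'a matroid \<Rightarrow> 'a set \<Rightarrow> nat" where
  "matroid_rank M X = Max (card ` {I \<in> indep_sets M. I \<subseteq> X})"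

definition cl :: "'a matroid \<Rightarrow> 'a set \<Rightarrow> 'a set" where
  "cl M X = {e \<in> ground M. matroid_rank M (insert e X) = matroid_rank M X}"

definition matroid_restrict :: "'a matroid \<Rightarrow> 'a set \<Rightarrow> 'a matroid" where
  "matroid_restrict M X = Matroid (ground M \<inter> X) {I \<in> indep_sets M. I \<subseteq> X}"

section \<open>The binary projective geometry and its restrictions\<close>

text \<open>The rank \<open>r\<close> is the cardinality of the finite index type \<open>'n\<close>; as types are
  nonempty, this ranges over exactly the \<open>r \<ge> 1\<close>. The constant \<open>PG\<close> is the matroid
  \<open>P\<^sub>r = PG(r-1,2)\<close>.\<close>

definition PG :: "(bit ^ 'n) matroid" where
  "PG = Matroid {v. v \<noteq> 0} {I. vec.independent I}"

definition PG_restrictions :: "(bit ^ 'n) matroid set" where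
  "PG_restrictions = {matroid_restrict PG X | X. X \<subseteq> ground PG}"

definition symdiff_restrict :: "(bit ^ 'n) matroid \<Rightarrow> (bit ^ 'n) set \<Rightarrow> (bit ^ 'n) matroid" where
  "symdiff_restrict M A = matroid_restrict PG (sym_diff (ground M) A)"

definition complementation :: "(bit ^ 'n) matroid \<Rightarrow> (bit ^ 'n) matroid" where
  "complementation M = symdiff_restrict M (ground PG)"

definition switching :: "(bit ^ 'n) set \<Rightarrow> (bit ^ 'n) matroid \<Rightarrow> (bit ^ 'n) matroid" where
  "switching C M = symdiff_restrict M C"

definition local_complementation ::
    "(bit ^ 'n) set \<Rightarrow> (bit ^ 'n) matroid \<Rightarrow> (bit ^ 'n) matroid" where
  "local_complementation C M = symdiff_restrict M (cl PG (ground M \<inter> C) - C)"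

definition switch_lc_step :: "(bit ^ 'n) matroid \<Rightarrow> (bit ^ 'n) matroid \<Rightarrow> bool" where
  "switch_lc_step M N \<longleftrightarrow>
     (\<exists>C. cocircuit PG C \<and> (N = switching C M \<or> N = local_complementation C M))"

definition comp_switch_lc_step :: "(bit ^ 'n) matroid \<Rightarrow> (bit ^ 'n) matroid \<Rightarrow> bool" where
  "comp_switch_lc_step M N \<longleftrightarrow> N = complementation M \<or> switch_lc_step M N"

instance bit :: finite
proof
  have "(UNIV :: bit set) \<subseteq> {0, 1}"
    using bit_not_zero_iff by blast
  then show "finite (UNIV :: bit set)"
    by (rule finite_subset) simp
qed

lemma is_matroid_PG: "is_matroid (PG :: (bit ^ 'n) matroid)"
proof -
  have zero: "0 \<notin> I" if "vec.independent I" for I :: "(bit ^ 'n) set"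
    using that vec.dependent_zero by blast
  have aug: "\<exists>x\<in>J - I. vec.independent (insert x I)"
    if I: "vec.independent I" and J: "vec.independent J" and lt: "card I < card J"
    for I J :: "(bit ^ 'n) set"
  proof -
    have "finite I"
      using vec.finiteI_independent[OF I] .
    then have "\<not> J \<subseteq> vec.span I"
      using vec.independent_span_bound[of I J] J lt by force
    then obtain x where "x \<in> J" "x \<notin> vec.span I"
      by blast
    then show ?thesis
      using I vec.independent_insertI[of x I] vec.span_base[of x I] by blast
  qed
  have "finite {v :: bit ^ 'n. v \<noteq> 0}"
    by (rule finite)
  moreover have "{I :: (bit ^ 'n) set. vec.independent I} \<subseteq> Pow {v. v \<noteq> 0}"
    using zero by fast
  moreover have "vec.independent J" if "vec.independent I" "J \<subseteq> I" for I J :: "(bit ^ 'n) set"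
    using that by (rule vec.independent_mono)
  moreover have "vec.independent ({} :: (bit ^ 'n) set)"
    by (rule vec.independent_empty)
  ultimately show ?thesis
    unfolding is_matroid_def PG_def matroid.sel mem_Collect_eq
    using aug by (intro conjI allI impI) blast+
qed

lemma is_matroid_restrict:
  assumes "is_matroid M"
  shows "is_matroid (matroid_restrict M X)"
proof -
  have fin: "finite (ground M)" and sub: "indep_sets M \<subseteq> Pow (ground M)"
    and empty: "{} \<in> indep_sets M"
    using assms unfolding is_matroid_def by simp_all
  have "\<forall>I J. I \<in> indep_sets M \<and> J \<subseteq> I \<longrightarrow> J \<in> indep_sets M"
    using assms unfolding is_matroid_def by (elim conjE)
  then have her: "J \<in> indep_sets M \<and> J \<subseteq> X" if "(I \<in> indep_sets M \<and> I \<subseteq> X) \<and> J \<subseteq> I" for I J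
    using that by blast
  have aug: "\<exists>x\<in>J - I. insert x I \<in> indep_sets M \<and> insert x I \<subseteq> X"
    if "(I \<in> indep_sets M \<and> I \<subseteq> X) \<and> (J \<in> indep_sets M \<and> J \<subseteq> X) \<and> card I < card J" for I J
  proof -
    have "\<forall>I J. I \<in> indep_sets M \<and> J \<in> indep_sets M \<and> card I < card J \<longrightarrow>
        (\<exists>x\<in>J - I. insert x I \<in> indep_sets M)"
      using assms unfolding is_matroid_def by (elim conjE)
    then have "\<exists>x\<in>J - I. insert x I \<in> indep_sets M"
      using that by presburger
    then show ?thesis
      using that by blast
  qed
  show ?thesis
    unfolding is_matroid_def matroid_restrict_def matroid.sel mem_Collect_eq
  proof (intro conjI)
    show "finite (ground M \<inter> X)"
      using fin by simp
    show "{I \<in> indep_sets M. I \<subseteq> X} \<subseteq> Pow (ground M \<inter> X)"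
      using sub by blast
    show "\<forall>I J. (I \<in> indep_sets M \<and> I \<subseteq> X) \<and> J \<subseteq> I \<longrightarrow> J \<in> indep_sets M \<and> J \<subseteq> X"
      by (intro allI impI) (rule her)
    show "\<forall>I J. (I \<in> indep_sets M \<and> I \<subseteq> X) \<and> (J \<in> indep_sets M \<and> J \<subseteq> X) \<and> card I < card J \<longrightarrow>
        (\<exists>x\<in>J - I. insert x I \<in> indep_sets M \<and> insert x I \<subseteq> X)"
      by (intro allI impI) (rule aug)
  qed (rule empty empty_subsetI)+
qed

lemma matroid_rank_PG: "matroid_rank PG X = vec.dim X" for X :: "(bit ^ 'n) set"
proof -
  obtain B where B: "B \<subseteq> X" "vec.independent B" "card B = vec.dim X"
    by (metis vec.basis_exists)
  have "card I \<le> vec.dim X" if "I \<subseteq> X" "vec.independent I" for I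
    using that vec.independent_card_le_dim by blast
  then have "Max (card ` {I. vec.independent I \<and> I \<subseteq> X}) = vec.dim X"
    using B by (intro Max_eqI) (auto intro!: image_eqI[of _ _ B])
  then show ?thesis
    by (simp add: matroid_rank_def PG_def)
qed

lemma matroid_rank_ground_PG: "matroid_rank PG (ground (PG :: (bit ^ 'n) matroid)) = CARD('n)"
proof -
  have "vec.dim {v :: bit ^ 'n. v \<noteq> 0} = vec.dim (insert 0 {v :: bit ^ 'n. v \<noteq> 0})"
    by (metis vec.span_insert_0 vec.dim_span)
  also have "insert 0 {v :: bit ^ 'n. v \<noteq> 0} = UNIV"
    by auto
  finally show ?thesis
    unfolding matroid_rank_PG by (simp only: PG_def matroid.sel vec_dim_card)
qed

end

(* Let E be the ground set of M and let C be a cocircuit of PG, i.e. the complement of a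
   hyperplane.  If E \<inter> C spans, then local complementation at C complements the whole
   hyperplane, so following it by switching at C complements M; if C - E spans, do the same
   with the two operations in the other order.  If neither spans, then E halves C.  This
   cannot happen for all C: weighting the points of E by 1 and the others by -1, each C would have
   weight 0, and so, by double counting, would PG, which has an odd number of points.  Hence
   complementation is always a composition of a switching and a local complementation. *)

theory Submission
  imports Defs
begin

section \<open>Dot product and hyperplanes over the two-element field\<close>

definition dot :: "bit ^ 'n \<Rightarrow> bit ^ 'n \<Rightarrow> bit" where
  "dot u v = (\<Sum>i\<in>UNIV. u $ i * v $ i)"

text \<open>A cocircuit of \<open>PG\<close> if \<open>u \<noteq> 0\<close>, and empty for
  \<open>u = 0\<close>.\<close>

definition hyperplane_compl :: "bit ^ 'n \<Rightarrow> (bit ^ 'n) set" where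
  "hyperplane_compl u = {v. dot u v = 1}"

lemma dot_0_right [simp]: "dot u 0 = 0"
  by (simp add: dot_def)

lemma dot_commute: "dot u v = dot v u"
  unfolding dot_def by (simp only: mult.commute)

lemma dot_add_right: "dot u (v + w) = dot u v + dot u w"
  unfolding dot_def by (simp only: vector_add_component distrib_left sum.distrib)

lemma dot_scale_right: "dot u (c *s v) = c * dot u v"
  unfolding dot_def by (simp only: vector_smult_component sum_distrib_left mult.left_commute)

lemma ex_dot_eq_1:
  assumes "u \<noteq> 0"
  shows "\<exists>v. dot u v = 1"
proof -
  obtain i where "u $ i = 1"
    using assms by (metis bit_not_zero_iff vec_eq_iff zero_index)
  then have "dot u (axis i 1) = 1"
    by (simp add: dot_def axis_def if_distrib[where f = "\<lambda>x. _ * x"] sum.delta cong: if_cong)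
  then show ?thesis ..
qed

lemma bit_vec_add_self [simp]: "v + v = 0" for v :: "bit ^ 'n"
  by (simp add: vec_eq_iff)

lemma bit_vec_add_self_left [simp]: "v + (v + w) = w" for v w :: "bit ^ 'n"
  by (simp flip: add.assoc)

lemma subspace_dot_eq_0: "vec.subspace {v. dot u v = 0}"
  by (simp add: vec.subspace_def dot_add_right dot_scale_right)

text \<open>Off the hyperplane \<open>dot u\<close> can only be 1, so any \<open>v\<close> there is
  \<open>c\<close> plus the hyperplane vector \<open>c + v\<close>.\<close>

lemma span_insert_hyperplane:
  assumes "dot u c = 1"
  shows "vec.span (insert c {v. dot u v = 0}) = UNIV"
proof -
  have "v \<in> vec.span (insert c {v. dot u v = 0})" for v
  proof (cases "dot u v = 0")
    case True
    then show ?thesis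
      by (simp add: vec.span_base)
  next
    case False
    then have "dot u (c + v) = 0"
      using assms by (simp add: dot_add_right)
    then have "c + (c + v) \<in> vec.span (insert c {v. dot u v = 0})"
      by (intro vec.span_add vec.span_base) auto
    then show ?thesis
      by simp
  qed
  then show ?thesis
    by blast
qed

text \<open>A hyperplane vector \<open>v\<close> is the sum of \<open>c\<close> and
  \<open>c + v\<close>, which both lie off the hyperplane.\<close>

lemma span_hyperplane_compl:
  assumes "u \<noteq> 0"
  shows "vec.span (hyperplane_compl u) = UNIV"
proof -
  obtain c where c: "dot u c = 1"
    using ex_dot_eq_1[OF assms] by blast
  have "v \<in> vec.span (hyperplane_compl u)" if "dot u v = 0" for v
  proof -
    have "c + (c + v) \<in> vec.span (hyperplane_compl u)"
      using c that
      by (intro vec.span_add vec.span_base) (auto simp: hyperplane_compl_def dot_add_right)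
    then show ?thesis
      by simp
  qed
  moreover have "c \<in> vec.span (hyperplane_compl u)"
    using c by (simp add: hyperplane_compl_def vec.span_base)
  ultimately have "vec.span (insert c {v. dot u v = 0}) \<subseteq> vec.span (hyperplane_compl u)"
    by (intro vec.span_minimal) auto
  then show ?thesis
    using span_insert_hyperplane[OF c] by blast
qed

section \<open>Bases and cocircuits of \<open>PG\<close>\<close>

lemma matroid_basis_PG:
  "matroid_basis PG B \<longleftrightarrow> vec.independent B \<and> vec.span B = UNIV"
proof (intro iffI conjI)
  assume basis: "matroid_basis PG B"
  then show ind: "vec.independent B"
    by (simp add: matroid_basis_def PG_def)
  show "vec.span B = UNIV"
  proof (rule ccontr)
    assume "vec.span B \<noteq> UNIV"
    then obtain x where x: "x \<notin> vec.span B"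
      by blast
    then have "vec.independent (insert x B)"
      using ind by (simp add: vec.independent_insertI)
    then have "insert x B = B"
      using basis by (auto simp: matroid_basis_def PG_def)
    then show False
      using x vec.span_base by blast
  qed
next
  assume B: "vec.independent B \<and> vec.span B = UNIV"
  have "I = B" if I: "vec.independent I" "B \<subseteq> I" for I
  proof (rule ccontr)
    assume "I \<noteq> B"
    then obtain x where x: "x \<in> I" "x \<notin> B"
      using I(2) by blast
    then have "x \<in> vec.span (I - {x})"
      using B I(2) vec.span_mono[of B "I - {x}"] by blast
    then show False
      using I(1) x(1) vec.dependent_def by blast
  qed
  then show "matroid_basis PG B"
    using B by (simp add: matroid_basis_def PG_def)
qed

text \<open>A cocircuit is a minimal set meeting every basis. A basis that misses this set would lie
  in a hyperplane. A proper subset omits some \<open>c\<close>, and a basis chosen from the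
  hyperplane and \<open>c\<close> avoids that subset.\<close>

lemma cocircuit_hyperplane_compl:
  assumes "u \<noteq> 0"
  shows "cocircuit PG (hyperplane_compl u)"
proof -
  have sub: "hyperplane_compl u \<subseteq> ground PG"
    by (auto simp: hyperplane_compl_def PG_def)
  have meets: "hyperplane_compl u \<inter> B \<noteq> {}" if "matroid_basis PG B" for B
  proof
    assume "hyperplane_compl u \<inter> B = {}"
    then have "B \<subseteq> {v. dot u v = 0}"
      by (auto simp: hyperplane_compl_def)
    then have "vec.span B \<subseteq> {v. dot u v = 0}"
      by (intro vec.span_minimal subspace_dot_eq_0)
    then have "{v. dot u v = 0} = UNIV"
      using that by (auto simp only: matroid_basis_PG)
    then show False
      using ex_dot_eq_1[OF assms] by (metis UNIV_I mem_Collect_eq zero_neq_one)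
  qed
  have avoids: "\<exists>B. matroid_basis PG B \<and> D \<inter> B = {}" if D: "D \<subset> hyperplane_compl u" for D
  proof -
    obtain c where c: "dot u c = 1" "c \<notin> D"
      using D by (auto simp: hyperplane_compl_def)
    obtain B where B: "B \<subseteq> insert c {v. dot u v = 0}" "vec.independent B"
      "insert c {v. dot u v = 0} \<subseteq> vec.span B"
      by (metis vec.maximal_independent_subset)
    then have "vec.span B = UNIV"
      using span_insert_hyperplane[OF c(1)] vec.span_minimal[OF B(3) vec.subspace_span] by blast
    moreover have "D \<inter> B = {}"
      using B(1) c(2) D by (fastforce simp: hyperplane_compl_def)
    ultimately show ?thesis
      using B(2) matroid_basis_PG by blast
  qed
  show ?thesis
    using sub meets avoids by (auto simp: cocircuit_def circuit_def dual_def)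
qed

section \<open>Cardinalities in hyperplane complements\<close>

text \<open>Translation by \<open>x + y\<close>, with \<open>x\<close> outside the span of \<open>A\<close> and \<open>y \<in> A\<close>, maps \<open>A\<close> out of its
  span, hence into \<open>B\<close>.\<close>

lemma card_le_if_not_spanning:
  assumes "u \<noteq> 0" and AB: "A \<union> B = hyperplane_compl u"
    and A: "vec.span A \<noteq> UNIV" and B: "vec.span B \<noteq> UNIV"
  shows "card A \<le> card B"
proof -
  have not_sub: "\<not> hyperplane_compl u \<subseteq> vec.span X" if "vec.span X \<noteq> UNIV" for X
    using that span_hyperplane_compl[OF assms(1)] vec.span_minimal[OF _ vec.subspace_span]
    by blast
  obtain x where x: "dot u x = 1" "x \<notin> vec.span A"
    using not_sub[OF A] by (auto simp: hyperplane_compl_def)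
  \<comment> \<open>A point of \<open>hyperplane_compl u\<close> outside the span of
    \<open>B\<close> is not in \<open>B\<close>, so it is in \<open>A\<close>.\<close>
  obtain y where y: "dot u y = 1" "y \<in> A"
    using not_sub[OF B] AB vec.span_base[of _ B] by (auto simp: hyperplane_compl_def)
  have "a + y + x \<in> B" if a: "a \<in> A" for a
  proof -
    have "a + y \<in> vec.span A"
      using a y by (intro vec.span_add vec.span_base)
    then have "a + y + x \<notin> vec.span A"
      using x(2) vec.span_add_eq by blast
    then have "a + y + x \<notin> A"
      using vec.span_base by blast
    moreover have "dot u a = 1"
      using a AB by (auto simp: hyperplane_compl_def)
    \<comment> \<open>Three vectors off the hyperplane add up to one off it, as
      \<open>1 + 1 + 1 = 1\<close>.\<close>
    then have "a + y + x \<in> hyperplane_compl u"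
      using x y by (simp add: hyperplane_compl_def dot_add_right)
    ultimately show ?thesis
      using AB by blast
  qed
  then show ?thesis
    by (intro card_inj_on_le[where f = "\<lambda>a. a + y + x"]) (auto simp: inj_on_def)
qed

text \<open>Translation by some \<open>w\<close> with \<open>dot w v = 1\<close> exchanges the two
  values of \<open>dot u v\<close>. In the double count, all nonzero points thus have the same
  multiplicity.\<close>

lemma card_dot_eq_1:
  fixes v :: "bit ^ 'n"
  assumes "v \<noteq> 0"
  shows "2 * card {u. dot u v = 1} = CARD(bit ^ 'n)"
proof -
  obtain w where w: "dot w v = 1"
    using ex_dot_eq_1[OF assms] dot_commute by metis
  have add: "dot (w + u) v = 1 + dot u v" for u
    using w dot_add_right[of v w u] by (simp add: dot_commute)
  have "bij_betw ((+) w) {u. dot u v = 1} {u. dot u v = 0}"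
    by (rule bij_betw_byWitness[where f' = "(+) w"]) (auto simp: add)
  then have "card {u. dot u v = 1} = card {u. dot u v = 0}"
    by (rule bij_betw_same_card)
  moreover have "UNIV = {u. dot u v = 1} \<union> {u. dot u v = 0}"
    by auto
  then have "CARD(bit ^ 'n) = card {u. dot u v = 1} + card {u. dot u v = 0}"
    by (subst card_Un_disjoint[symmetric]) auto
  ultimately show ?thesis
    by simp
qed

lemma ex_hyperplane_compl_not_halved:
  fixes E :: "(bit ^ 'n) set"
  shows "\<exists>u. u \<noteq> 0 \<and> card (hyperplane_compl u \<inter> E) \<noteq> card (hyperplane_compl u - E)"
proof (rule ccontr)
  assume "\<not> ?thesis"
  then have halved: "card (hyperplane_compl u \<inter> E) = card (hyperplane_compl u - E)"
    if "u \<noteq> 0" for u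
    using that by blast
  define g :: "bit ^ 'n \<Rightarrow> int" where "g v = (if v \<in> E then 1 else -1)" for v
  have sum_g: "sum g C = int (card (C \<inter> E)) - int (card (C - E))" for C
  proof -
    have "sum g C = sum g (C \<inter> E) + sum g (C - E)"
      by (rule sum.Int_Diff) simp
    then show ?thesis
      by (simp add: g_def)
  qed
  \<comment> \<open>Including \<open>u = 0\<close> lets the double sum run over the whole
    space.\<close>
  have "sum g (hyperplane_compl u) = 0" for u
  proof (cases "u = 0")
    case True
    then have "hyperplane_compl u = {}"
      by (simp add: hyperplane_compl_def dot_commute)
    then show ?thesis
      by simp
  next
    case False
    then show ?thesis
      by (simp add: sum_g halved)
  qed
  \<comment> \<open>The factor 2 makes \<open>card_dot_eq_1\<close> applicable without
    division.\<close>
  then have "0 = (\<Sum>u\<in>UNIV. 2 * sum g (hyperplane_compl u))"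
    by simp
  also have "\<dots> = (\<Sum>u\<in>UNIV. \<Sum>v\<in>UNIV. if dot u v = 1 then 2 * g v else 0)"
    by (simp add: hyperplane_compl_def sum_distrib_left flip: sum.inter_filter)
  also have "\<dots> = (\<Sum>v\<in>UNIV. \<Sum>u\<in>UNIV. if dot u v = 1 then 2 * g v else 0)"
    by (rule sum.swap)
  also have "\<dots> = (\<Sum>v\<in>UNIV. int (2 * card {u. dot u v = 1}) * g v)"
    by (simp add: mult_ac flip: sum.inter_filter)
  \<comment> \<open>The zero vector drops out because \<open>dot u 0\<close> is never 1.\<close>
  also have "\<dots> = (\<Sum>v\<in>UNIV - {0}. int (2 * card {u. dot u v = 1}) * g v)"
    by (simp add: sum.remove[of UNIV 0])
  also have "\<dots> = int CARD(bit ^ 'n) * sum g (UNIV - {0})"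
    unfolding sum_distrib_left by (intro sum.cong) (simp_all add: card_dot_eq_1)
  finally have "sum g (UNIV - {0}) = 0"
    by simp
  moreover have "odd (sum g (UNIV - {0}))"
  proof -
    have "odd (g v)" for v
      by (simp add: g_def)
    then have "even (sum g A) \<longleftrightarrow> even (card A)" for A
      by (simp add: even_sum_iff)
    \<comment> \<open>Applied to the all-ones vector, \<open>card_dot_eq_1\<close> shows that the
      space has an even number of vectors, hence an odd number of nonzero ones.\<close>
    moreover have "even CARD(bit ^ 'n)"
      using card_dot_eq_1[of "1 :: bit ^ 'n"] by (metis dvd_triv_left zero_neq_one)
    then have "odd (card (UNIV - {0 :: bit ^ 'n}))"
      by (simp add: card_Diff_singleton)
    ultimately show ?thesis
      by simp
  qed
  ultimately show False
    by simp
qed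

section \<open>Composing the operations\<close>

text \<open>Independent sets of \<open>PG\<close> avoid the zero vector, so ground sets need
  comparing only within \<open>ground PG\<close>.\<close>

lemma matroid_restrict_PG_Int_ground:
  "matroid_restrict PG (ground PG \<inter> X) = matroid_restrict PG X"
proof -
  have "I \<subseteq> ground PG" if "I \<in> indep_sets PG" for I :: "(bit ^ 'n) set"
    using that is_matroid_PG unfolding is_matroid_def by blast
  then show ?thesis
    by (auto simp: matroid_restrict_def)
qed

lemma ground_symdiff_restrict:
  "ground (symdiff_restrict M A) = ground PG \<inter> sym_diff (ground M) A"
  by (simp add: symdiff_restrict_def matroid_restrict_def)

lemma symdiff_restrict_symdiff_restrict:
  "symdiff_restrict (symdiff_restrict M A) B = symdiff_restrict M (sym_diff A B)"
proof -
  have "ground PG \<inter> sym_diff (ground (symdiff_restrict M A)) B =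
      ground PG \<inter> sym_diff (ground M) (sym_diff A B)"
    by (auto simp: ground_symdiff_restrict)
  then show ?thesis
    by (metis symdiff_restrict_def matroid_restrict_PG_Int_ground)
qed

lemma cl_PG_spanning:
  assumes "vec.span X = UNIV"
  shows "cl PG X = ground PG"
proof -
  have "vec.dim (insert e X) = vec.dim X" for e
    using assms by (metis UNIV_I vec.dim_span vec.span_redundant)
  then show ?thesis
    by (simp add: cl_def matroid_rank_PG)
qed

lemma switching_local_complementation:
  assumes "vec.span (C \<inter> ground M) = UNIV" and "C \<subseteq> ground PG"
  shows "switching C (local_complementation C M) = complementation M"
proof -
  have "sym_diff (ground PG - C) C = ground PG"
    using assms(2) by blast
  then show ?thesis
    using assms(1)
    by (simp add: switching_def local_complementation_def complementation_def Int_commute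
        symdiff_restrict_symdiff_restrict cl_PG_spanning)
qed

text \<open>Inside \<open>C\<close>, switching exchanges the points of \<open>M\<close> with the
  others, so the local complementation that follows takes the closure of
  \<open>C - ground M\<close>.\<close>

lemma local_complementation_switching:
  assumes "vec.span (C - ground M) = UNIV" and "C \<subseteq> ground PG"
  shows "local_complementation C (switching C M) = complementation M"
proof -
  have "ground (switching C M) \<inter> C = C - ground M"
    using assms(2) by (auto simp: switching_def ground_symdiff_restrict)
  moreover have "sym_diff C (ground PG - C) = ground PG"
    using assms(2) by blast
  ultimately show ?thesis
    using assms(1)
    by (simp add: local_complementation_def cl_PG_spanning)
      (simp add: switching_def complementation_def symdiff_restrict_symdiff_restrict)
qed

lemma switch_lc_steps_complementation: "switch_lc_step\<^sup>*\<^sup>* M (complementation M)"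
proof -
  obtain u where u: "u \<noteq> 0"
    and ne: "card (hyperplane_compl u \<inter> ground M) \<noteq> card (hyperplane_compl u - ground M)"
    using ex_hyperplane_compl_not_halved by blast
  define C where "C = hyperplane_compl u"
  have C: "cocircuit PG C"
    using u by (simp add: C_def cocircuit_hyperplane_compl)
  then have sub: "C \<subseteq> ground PG"
    by (simp add: cocircuit_def circuit_def dual_def)
  have un: "C \<inter> ground M \<union> (C - ground M) = C" "C - ground M \<union> C \<inter> ground M = C"
    by blast+
  \<comment> \<open>If neither part spanned, the bound applied in both orders would make their
    cardinalities equal, against \<open>ne\<close>.\<close>
  have "vec.span (C \<inter> ground M) = UNIV \<or> vec.span (C - ground M) = UNIV"
    using ne card_le_if_not_spanning[OF u un(1)[unfolded C_def]]
      card_le_if_not_spanning[OF u un(2)[unfolded C_def]]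
    unfolding C_def by (meson le_antisym)
  then consider "complementation M = switching C (local_complementation C M)"
    | "complementation M = local_complementation C (switching C M)"
    using switching_local_complementation local_complementation_switching sub by metis
  then show ?thesis
  proof cases
    case 1
    have "switch_lc_step M (local_complementation C M)"
      "switch_lc_step (local_complementation C M) (complementation M)"
      using C 1 by (auto simp: switch_lc_step_def)
    then show ?thesis
      by (meson converse_rtranclp_into_rtranclp r_into_rtranclp)
  next
    case 2
    have "switch_lc_step M (switching C M)"
      "switch_lc_step (switching C M) (complementation M)"
      using C 2 by (auto simp: switch_lc_step_def)
    then show ?thesis
      by (meson converse_rtranclp_into_rtranclp r_into_rtranclp)
  qed
qed

theorem proposition5p2:
  fixes N :: "(bit ^ 'n) matroid"
  assumes "N \<in> PG_restrictions"
    and "comp_switch_lc_step\<^sup>*\<^sup>* PG N"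
  shows "switch_lc_step\<^sup>*\<^sup>* PG N"
  using assms(2)
proof induction
  case base
  show ?case
    by simp
next
  case (step M N)
  \<comment> \<open>A complementation step is replaced by a path of the other two operations; any
    other step is kept.\<close>
  then show ?case
    by (metis comp_switch_lc_step_def switch_lc_steps_complementation rtranclp.rtrancl_into_rtrancl
        rtranclp_trans)
qed

end
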